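(* There exists a function $f_0\colon\mathbb{N}\to\{+1,-1\}$ with the following property: for Lebesgue-almost every $\alpha>1$ there is a constant $c_\alpha>0$ such that \[ S_\alpha(f_0,x)-\alpha^{-1}S(f_0,x)\ \ge\ c_\alpha\,\|f_0|_x\|_2\,\sqrt{\log\log x} \] holds for infinitely many $x\in\mathbb{N}$.
   Context: $\mathbb{N}=\{1,2,3,\dots\}$, $\lfloor \xi\rfloor$ is the integer part of $\xi$, and $\mathcal{B}(\alpha)=\{\lfloor n\alpha\rfloor : n\in\mathbb{N}\}$ for real $\alpha\ge1$. For $x\ge1$: $S_\alpha(f,x)=\sum_{1\le m\le x,\ m\in\mathcal{B}(\alpha)} f(m)$, $S(f,x)=\sum_{1\le m\le x} f(m)$, and $\|f|_x\|_2=\big(\sum_{1\le m\le x}|f(m)|^2\big)^{1/2}$ (so $\|f_0|_x\|_2=\sqrt{\lfloor x\rfloor}$ here). *)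

theory Defs
  imports "HOL-Analysis.Analysis"
begin

definition beatty :: "real \<Rightarrow> nat set" where
  "beatty \<alpha> = {nat \<lfloor>real n * \<alpha>\<rfloor> | n. n \<ge> 1}"

definition S_full :: "(nat \<Rightarrow> real) \<Rightarrow> real \<Rightarrow> real" where
  "S_full f x = (\<Sum>m\<in>{m. 1 \<le> m \<and> real m \<le> x}. f m)"

definition S_beatty :: "real \<Rightarrow> (nat \<Rightarrow> real) \<Rightarrow> real \<Rightarrow> real" where
  "S_beatty \<alpha> f x = (\<Sum>m\<in>{m. 1 \<le> m \<and> real m \<le> x \<and> m \<in> beatty \<alpha>}. f m)"

definition l2_trunc :: "(nat \<Rightarrow> real) \<Rightarrow> real \<Rightarrow> real" where
  "l2_trunc f x = sqrt (\<Sum>m\<in>{m. 1 \<le> m \<and> real m \<le> x}. (f m)\<^sup>2)"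

end

theory Submission
  imports Defs "HOL-Probability.Probability"
begin

text \<open>
  Choose the values \<open>f\<^sub>0 m\<close> as independent fair signs. For fixed \<open>\<alpha> > 1\<close> the quantity to bound is
  \<open>\<Sum>m\<le>x. a m * f\<^sub>0 m\<close> with \<open>a m = 1\<^sub>B m - 1 / \<alpha>\<close>, where \<open>B\<close> is the Beatty sequence, and
  \<open>\<bar>a m\<bar>\<close> lies between \<open>min (1 / \<alpha>) (1 - 1 / \<alpha>)\<close> and \<open>1\<close>; this is all that is used about \<open>B\<close>.
  A lower bound of iterated logarithm type then holds almost surely: a fourth moment estimate shows
  that a sum over a block exceeds a quarter of its standard deviation with probability at least
  \<open>1/20\<close>, hence \<open>j\<close> consecutive sub-blocks of length \<open>L\<close> all do so with probability at least
  \<open>20 ^ -j\<close>, making their total at least of order \<open>j * sqrt L\<close>, i.e. \<open>sqrt j\<close> times the standard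
  deviation of the whole. With \<open>j\<close> about \<open>log 20 k\<close> in the \<open>k\<close>-th block these probabilities are at
  least \<open>1 / k\<close>, so the second Borel--Cantelli lemma applies, and block ends near \<open>4 ^ k\<^sup>2\<close> give
  \<open>ln (ln x)\<close> of order \<open>j\<close>. By Fubini, almost every choice of signs works for almost every \<open>\<alpha>\<close>.
\<close>

section \<open>Moments of weighted sums of independent signs\<close>

locale rademacher = prob_space M for M :: "'a measure" +
  fixes \<epsilon> :: "nat \<Rightarrow> 'a \<Rightarrow> real"
  assumes indep: "indep_vars (\<lambda>_. borel) \<epsilon> UNIV"
    and sign: "\<epsilon> n \<omega> = 1 \<or> \<epsilon> n \<omega> = -1"
    and mean: "expectation (\<epsilon> n) = 0"
begin

definition signed_sum :: "(nat \<Rightarrow> real) \<Rightarrow> nat set \<Rightarrow> 'a \<Rightarrow> real" where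
  "signed_sum a A \<omega> = (\<Sum>m\<in>A. a m * \<epsilon> m \<omega>)"

lemma sign_measurable [measurable]: "\<epsilon> n \<in> borel_measurable M"
  using indep by (auto simp: indep_vars_def)

lemma signed_sum_measurable [measurable]: "signed_sum a A \<in> borel_measurable M"
  unfolding signed_sum_def by measurable

lemma abs_signed_sum_le: "\<bar>signed_sum a A \<omega>\<bar> \<le> (\<Sum>m\<in>A. \<bar>a m\<bar>)"
proof -
  have "\<bar>a m * \<epsilon> m \<omega>\<bar> \<le> \<bar>a m\<bar>" for m
    using sign[of m \<omega>] by auto
  then show ?thesis
    unfolding signed_sum_def by (intro order_trans[OF sum_abs] sum_mono) auto
qed

lemma integrable_signed_sum_power [simp]: "integrable M (\<lambda>\<omega>. signed_sum a A \<omega> ^ n)"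
  by (rule integrable_const_bound[where B = "(\<Sum>m\<in>A. \<bar>a m\<bar>) ^ n"])
    (auto simp: power_abs intro!: power_mono abs_signed_sum_le)

lemma integrable_signed_sum [simp]: "integrable M (signed_sum a A)"
  using integrable_signed_sum_power[of a A 1] by simp

lemma integrable_sign [simp]: "integrable M (\<epsilon> n)"
proof (rule integrable_const_bound[where B = 1])
  show "AE \<omega> in M. norm (\<epsilon> n \<omega>) \<le> 1"
  proof (rule AE_I2)
    show "norm (\<epsilon> n \<omega>) \<le> 1" for \<omega>
      using sign[of n \<omega>] by auto
  qed
qed simp

text \<open>The sum involves only signs with index other than \<open>i\<close>, so it is independent
  of \<open>\<epsilon> i\<close>, whose mean is 0. This removes the terms of odd degree in
  \<open>\<epsilon> i\<close> from the moment expansions below.\<close>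

lemma expectation_sign_times_signed_sum_power:
  assumes "finite A" "i \<notin> A"
  shows "integrable M (\<lambda>\<omega>. \<epsilon> i \<omega> * signed_sum a A \<omega> ^ n)"
    and "expectation (\<lambda>\<omega>. \<epsilon> i \<omega> * signed_sum a A \<omega> ^ n) = 0"
proof -
  \<comment> \<open>Index \<open>i\<close> gets weight 1 instead of \<open>a i\<close>, so that
    \<open>X i\<close> is the bare sign.\<close>
  define X where "X m \<omega> = (if m = i then 1 else a m) * \<epsilon> m \<omega>" for m \<omega>
  have "indep_vars (\<lambda>_. borel) X (insert i A)"
    unfolding X_def by (rule indep_vars_compose2[OF indep_vars_subset[OF indep]]) auto
  from indep_vars_sum[OF assms this]
  have "indep_var borel (X i) borel (\<lambda>\<omega>. \<Sum>m\<in>A. X m \<omega>)" .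
  also have "X i = \<epsilon> i"
    by (simp add: X_def fun_eq_iff)
  also have "(\<lambda>\<omega>. \<Sum>m\<in>A. X m \<omega>) = signed_sum a A"
    using assms by (auto simp: X_def signed_sum_def fun_eq_iff intro!: sum.cong)
  finally have "indep_var borel (\<epsilon> i) borel (\<lambda>\<omega>. signed_sum a A \<omega> ^ n)"
    using indep_var_compose[of borel "\<epsilon> i" borel "signed_sum a A" id borel "\<lambda>x. x ^ n" borel]
    by (simp add: comp_def)
  then show "integrable M (\<lambda>\<omega>. \<epsilon> i \<omega> * signed_sum a A \<omega> ^ n)"
    and "expectation (\<lambda>\<omega>. \<epsilon> i \<omega> * signed_sum a A \<omega> ^ n) = 0"
    by (auto intro!: indep_var_integrable simp: indep_var_lebesgue_integral mean)
qed

lemma signed_sum_insert: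
  "finite A \<Longrightarrow> i \<notin> A \<Longrightarrow> signed_sum a (insert i A) \<omega> = a i * \<epsilon> i \<omega> + signed_sum a A \<omega>"
  by (simp add: signed_sum_def)

lemma expectation_signed_sum: "expectation (signed_sum a A) = 0"
  unfolding signed_sum_def by (simp add: mean)

lemma expectation_signed_sum_squared:
  "finite A \<Longrightarrow> expectation (\<lambda>\<omega>. (signed_sum a A \<omega>)\<^sup>2) = (\<Sum>m\<in>A. (a m)\<^sup>2)"
proof (induction A rule: finite_induct)
  case empty
  then show ?case by (simp add: signed_sum_def)
next
  case (insert i A)
  note e = expectation_sign_times_signed_sum_power[OF insert.hyps, of a 1, simplified]
  have "(signed_sum a (insert i A) \<omega>)\<^sup>2 =
      (signed_sum a A \<omega>)\<^sup>2 + 2 * a i * (\<epsilon> i \<omega> * signed_sum a A \<omega>) + (a i)\<^sup>2" for \<omega>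
    using sign[of i \<omega>] insert.hyps
    by (auto simp: signed_sum_insert power2_eq_square algebra_simps)
  then show ?case
    using insert e by (simp add: prob_space)
qed

text \<open>Since \<open>\<epsilon> i\<close> squares to 1 and odd terms have mean 0, adding
  \<open>i\<close> contributes a mixed term and \<open>a i ^ 4\<close>; the right-hand side grows by
  the same mixed term and \<open>3 * a i ^ 4\<close>.\<close>

lemma expectation_signed_sum_fourth_le:
  "finite A \<Longrightarrow> expectation (\<lambda>\<omega>. signed_sum a A \<omega> ^ 4) \<le> 3 * (\<Sum>m\<in>A. (a m)\<^sup>2)\<^sup>2"
proof (induction A rule: finite_induct)
  case empty
  then show ?case by (simp add: signed_sum_def)
next
  case (insert i A)
  note e1 = expectation_sign_times_signed_sum_power[OF insert.hyps, of a 1, simplified]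
  note e3 = expectation_sign_times_signed_sum_power[OF insert.hyps, of a 3]
  have "signed_sum a (insert i A) \<omega> ^ 4 =
      signed_sum a A \<omega> ^ 4 + 4 * a i * (\<epsilon> i \<omega> * signed_sum a A \<omega> ^ 3)
      + 6 * (a i)\<^sup>2 * (signed_sum a A \<omega>)\<^sup>2 + 4 * a i ^ 3 * (\<epsilon> i \<omega> * signed_sum a A \<omega>) + a i ^ 4" for \<omega>
    using sign[of i \<omega>] insert.hyps
    by (auto simp: signed_sum_insert power2_eq_square power3_eq_cube power4_eq_xxxx algebra_simps)
  then have "expectation (\<lambda>\<omega>. signed_sum a (insert i A) \<omega> ^ 4) =
      expectation (\<lambda>\<omega>. signed_sum a A \<omega> ^ 4) + 6 * (a i)\<^sup>2 * (\<Sum>m\<in>A. (a m)\<^sup>2) + a i ^ 4"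
    using e1 e3 insert.hyps by (simp add: prob_space expectation_signed_sum_squared)
  also have "\<dots> \<le> 3 * ((a i)\<^sup>2 + (\<Sum>m\<in>A. (a m)\<^sup>2))\<^sup>2"
  proof -
    have "3 * ((a i)\<^sup>2 + (\<Sum>m\<in>A. (a m)\<^sup>2))\<^sup>2 =
        3 * (\<Sum>m\<in>A. (a m)\<^sup>2)\<^sup>2 + 6 * (a i)\<^sup>2 * (\<Sum>m\<in>A. (a m)\<^sup>2) + 3 * a i ^ 4"
      by (simp add: power2_sum)
    moreover have "0 \<le> a i ^ 4" by simp
    ultimately show ?thesis
      using insert.IH by linarith
  qed
  finally show ?case
    using insert.hyps by simp
qed

end

section \<open>A one-sided lower tail bound from the first, second and fourth moments\<close>

text \<open>
  For a variable \<open>x\<close> with mean 0, variance 1 and fourth moment at most 3 the left-hand side has mean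
  at least \<open>3/16\<close>. The linear term makes the resulting tail bound one-sided without any symmetry.
\<close>

lemma quartic_le_indicator:
  fixes x :: real
  shows "x + x\<^sup>2 - x ^ 4 / 6 - 5 / 16 \<le> 15 / 4 * indicator {1 / 4..} x"
proof -
  consider "x \<le> 0" | "0 < x" "x < 1 / 4" | "1 / 4 \<le> x"
    by linarith
  then show ?thesis
  proof cases
    case 1
    define y where "y = - x"
    with 1 have y: "0 \<le> y" by simp
    have "0 \<le> y ^ 3 - 6 * y + 6"
    proof (cases "y \<le> 1")
      case True
      moreover have "0 \<le> y ^ 3" using y by simp
      ultimately show ?thesis by linarith
    next
      case False
      \<comment> \<open>The cubic \<open>y ^ 3 - 27 / 4 * y + 27 / 4\<close> has a double root at
        3/2 and its third root at -3; the cubic in question is larger by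
        \<open>3 / 4 * (y - 1)\<close>, which is positive here.\<close>
      moreover have "0 \<le> (y - 3 / 2)\<^sup>2 * (y + 3)"
        using y by simp
      moreover have "y ^ 3 = (y - 3 / 2)\<^sup>2 * (y + 3) + 27 / 4 * y - 27 / 4"
        by (simp add: power2_eq_square power3_eq_cube field_simps)
      ultimately show ?thesis by linarith
    qed
    then have "0 \<le> y * (y ^ 3 - 6 * y + 6)"
      using y by simp
    then have "x + x\<^sup>2 - x ^ 4 / 6 \<le> 0"
      by (simp add: y_def power2_eq_square power3_eq_cube power4_eq_xxxx algebra_simps)
    with 1 show ?thesis by simp
  next
    case 2
    then have "x\<^sup>2 \<le> (1 / 4)\<^sup>2"
      by (intro power_mono) auto
    then have "x\<^sup>2 \<le> 1 / 16"
      by (simp add: power2_eq_square)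
    moreover have "0 \<le> x ^ 4" by simp
    ultimately have "x + x\<^sup>2 - x ^ 4 / 6 - 5 / 16 \<le> 0"
      using 2 by linarith
    with 2 show ?thesis by simp
  next
    case 3
    \<comment> \<open>A sixth of the first square plus a quarter of the second is
      \<open>x ^ 4 / 6 - x\<^sup>2 - x + 107 / 32\<close>, so the left-hand side below is at most
      97/32 < 15/4.\<close>
    have "0 \<le> (x\<^sup>2 - 15/4)\<^sup>2" "0 \<le> (x - 2)\<^sup>2" by simp_all
    then have "x + x\<^sup>2 - x ^ 4 / 6 - 5 / 16 \<le> 15 / 4" 
      by (simp add: power2_eq_square power4_eq_xxxx algebra_simps)
    with 3 show ?thesis by simp
  qed
qed


context rademacher
begin

text \<open>The quartic inequality is integrated for the sum divided by its true standard deviation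
  \<open>\<sigma>\<close>. As \<open>s\<close> is only a lower bound for \<open>\<sigma>\<close>,
  one threshold serves all blocks of a given length.\<close>

lemma prob_signed_sum_ge:
  assumes "finite A" and s: "0 < s" "s\<^sup>2 \<le> (\<Sum>m\<in>A. (a m)\<^sup>2)"
  shows "1 / 20 \<le> prob {\<omega> \<in> space M. s / 4 \<le> signed_sum a A \<omega>}"
proof -
  define \<sigma> where "\<sigma> = sqrt (\<Sum>m\<in>A. (a m)\<^sup>2)"
  have \<sigma>2: "\<sigma>\<^sup>2 = (\<Sum>m\<in>A. (a m)\<^sup>2)"
    unfolding \<sigma>_def by (simp add: sum_nonneg)
  have "s \<le> \<sigma>"
    unfolding \<sigma>_def using s(2) by (rule real_le_rsqrt)
  with s have \<sigma>: "0 < \<sigma>" by simp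
  define Y where "Y \<omega> = signed_sum a A \<omega> / \<sigma>" for \<omega>
  have [measurable]: "Y \<in> borel_measurable M"
    unfolding Y_def by measurable
  have Y_int [simp]: "integrable M Y" "integrable M (\<lambda>\<omega>. Y \<omega> ^ n)" for n
    unfolding Y_def by (simp_all add: power_divide)
  have Y1: "expectation Y = 0"
    unfolding Y_def by (simp add: expectation_signed_sum)
  have Y2: "expectation (\<lambda>\<omega>. (Y \<omega>)\<^sup>2) = 1"
    using \<sigma> assms(1) unfolding Y_def
    by (simp add: power_divide expectation_signed_sum_squared flip: \<sigma>2)
  have Y4: "expectation (\<lambda>\<omega>. Y \<omega> ^ 4) \<le> 3"
    using \<sigma> expectation_signed_sum_fourth_le[OF assms(1), of a] unfolding Y_def
    by (simp add: power_divide field_simps flip: \<sigma>2)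
  have ev: "{\<omega> \<in> space M. 1 / 4 \<le> Y \<omega>} \<in> events"
    by measurable
  \<comment> \<open>The moments give 1 - 3/6 - 5/16 = 3/16; division by 15/4 yields the final
    1/20.\<close>
  have "3 / 16 \<le> expectation (\<lambda>\<omega>. Y \<omega> + (Y \<omega>)\<^sup>2 - Y \<omega> ^ 4 / 6 - 5 / 16)"
    using Y1 Y2 Y4 by (simp add: prob_space)
  also have "\<dots> \<le> expectation (\<lambda>\<omega>. 15 / 4 * indicator {\<omega> \<in> space M. 1 / 4 \<le> Y \<omega>} \<omega>)"
  proof (rule integral_mono)
    fix \<omega> assume "\<omega> \<in> space M"
    then show "Y \<omega> + (Y \<omega>)\<^sup>2 - Y \<omega> ^ 4 / 6 - 5 / 16
        \<le> 15 / 4 * indicator {\<omega> \<in> space M. 1 / 4 \<le> Y \<omega>} \<omega>"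
      using quartic_le_indicator[of "Y \<omega>"] by (auto simp: indicator_def)
  qed (use ev in \<open>auto simp: less_top[symmetric]\<close>)
  also have "\<dots> = 15 / 4 * prob {\<omega> \<in> space M. 1 / 4 \<le> Y \<omega>}"
    using ev by (simp add: Int_absorb2 subset_eq)
  also have "prob {\<omega> \<in> space M. 1 / 4 \<le> Y \<omega>} \<le> prob {\<omega> \<in> space M. s / 4 \<le> signed_sum a A \<omega>}"
    using \<sigma> \<open>s \<le> \<sigma>\<close> by (intro finite_measure_mono) (auto simp: Y_def field_simps)
  finally show ?thesis by simp
qed

lemma prob_abs_signed_sum_ge_le:
  assumes "finite A" "0 < t"
  shows "prob {\<omega> \<in> space M. t \<le> \<bar>signed_sum a A \<omega>\<bar>} \<le> (\<Sum>m\<in>A. (a m)\<^sup>2) / t\<^sup>2"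
  using Chebyshev_inequality[OF signed_sum_measurable integrable_signed_sum_power assms(2), of a A]
  unfolding expectation_signed_sum diff_0_right expectation_signed_sum_squared[OF assms(1)] .

lemma indep_vars_signed_sum:
  assumes "disjoint_family_on T I"
  shows "indep_vars (\<lambda>_. borel) (\<lambda>i. signed_sum a (T i)) I"
proof -
  \<comment> \<open>Each sum is a function of the sign sequence restricted to its own index
    set.\<close>
  have "indep_vars (\<lambda>_. borel)
      (\<lambda>i \<omega>. (\<lambda>f. \<Sum>m\<in>T i. a m * f m) (restrict (\<lambda>m. \<epsilon> m \<omega>) (T i))) I"
    by (rule indep_vars_compose2[OF indep_vars_restrict[OF indep _ assms]]) auto
  also have "(\<lambda>i \<omega>. (\<lambda>f. \<Sum>m\<in>T i. a m * f m) (restrict (\<lambda>m. \<epsilon> m \<omega>) (T i))) =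
      (\<lambda>i. signed_sum a (T i))"
    by (intro ext) (simp add: signed_sum_def)
  finally show ?thesis .
qed

end

section \<open>The second Borel-Cantelli lemma\<close>

text \<open>By independence and \<open>1 - p \<le> exp (- p)\<close>, the probability that no event
  occurs from \<open>K\<close> to \<open>N - 1\<close> is at most the exponential of minus the sum
  of their probabilities. Were \<open>prob Z\<close> positive, its logarithm would bound all these
  sums, against divergence.\<close>

lemma (in prob_space) borel_cantelli_AE2:
  assumes indep: "indep_vars (\<lambda>_. count_space UNIV) V UNIV"
    and div: "\<not> summable (\<lambda>k::nat. prob {\<omega> \<in> space M. V k \<omega>})"
  shows "AE \<omega> in M. \<exists>\<^sub>\<infinity>k. V k \<omega>"
proof -
  have [measurable]: "V k \<in> measurable M (count_space UNIV)" for k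
    using indep by (auto simp: indep_vars_def)
  define p where "p k = prob {\<omega> \<in> space M. V k \<omega>}" for k
  have "AE \<omega> in M. \<exists>k\<ge>K. V k \<omega>" for K
  proof -
    define Z where "Z = {\<omega> \<in> space M. \<forall>k\<ge>K. \<not> V k \<omega>}"
    have Z [measurable]: "Z \<in> events"
      unfolding Z_def by measurable
    \<comment> \<open>\<open>K < N\<close> keeps the index set nonempty, as the product formula for
      independent events requires.\<close>
    have le: "prob Z \<le> exp (- (\<Sum>k\<in>{K..<N}. p k))" if "K < N" for N
    proof -
      have "prob Z \<le> prob (\<Inter>k\<in>{K..<N}. V k -` {False} \<inter> space M)"
      proof (rule finite_measure_mono)
        show "Z \<subseteq> (\<Inter>k\<in>{K..<N}. V k -` {False} \<inter> space M)"
        proof (intro subsetI INT_I IntI vimageI2)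
          fix \<omega> k assume *: "\<omega> \<in> Z" "k \<in> {K..<N}"
          then show "\<omega> \<in> space M" "V k \<omega> \<in> {False}"
            unfolding Z_def by simp_all
        qed
        show "(\<Inter>k\<in>{K..<N}. V k -` {False} \<inter> space M) \<in> events"
          using that by (intro sets.finite_INT measurable_sets[where A = "count_space UNIV"]) simp_all
      qed
      also have "\<dots> = (\<Prod>k\<in>{K..<N}. prob (V k -` {False} \<inter> space M))"
        using that by (intro indep_varsD[OF indep]) simp_all
      also have "\<dots> \<le> (\<Prod>k\<in>{K..<N}. exp (- p k))"
      proof (intro prod_mono conjI)
        fix k
        have "V k -` {False} \<inter> space M = space M - {\<omega> \<in> space M. V k \<omega>}"
          by auto
        then have "prob (V k -` {False} \<inter> space M) = 1 - p k"
          by (simp add: prob_compl p_def)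
        then show "prob (V k -` {False} \<inter> space M) \<le> exp (- p k)"
          using exp_ge_add_one_self[of "- p k"] by simp
      qed simp
      also have "\<dots> = exp (- (\<Sum>k\<in>{K..<N}. p k))"
        by (simp flip: exp_sum sum_negf)
      finally show ?thesis .
    qed
    have "prob Z = 0"
    proof (rule ccontr)
      assume "prob Z \<noteq> 0"
      then have pos: "0 < prob Z" by (simp add: less_le)
      have "(\<Sum>k<n. p (k + K)) \<le> - ln (prob Z)" for n
      proof (cases "n = 0")
        case True
        then show ?thesis using pos by simp
      next
        case False
        have "(\<Sum>k<n. p (k + K)) = (\<Sum>k\<in>{K..<n + K}. p k)"
          by (rule sum.reindex_bij_witness[of _ "\<lambda>k. k - K" "\<lambda>k. k + K"]) auto
        moreover have "ln (prob Z) \<le> - (\<Sum>k\<in>{K..<n + K}. p k)"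
          using le[of "n + K"] False pos by (simp flip: ln_le_cancel_iff)
        ultimately show ?thesis by simp
      qed
      then have "summable (\<lambda>k. p (k + K))"
        by (intro bounded_imp_summable[where B = "- ln (prob Z)"])
          (auto simp: p_def lessThan_Suc_atMost[symmetric] simp del: sum.lessThan_Suc)
      then show False
        using div unfolding p_def by (simp add: summable_iff_shift[of "\<lambda>k. prob {\<omega> \<in> space M. V k \<omega>}"])
    qed
    then have "AE \<omega> in M. \<omega> \<notin> Z"
      by (simp add: prob_eq_0)
    then show ?thesis
      by (auto simp: Z_def elim!: AE_mp)
  qed
  then show ?thesis
    by (simp add: INFM_nat_le AE_all_countable)
qed

section \<open>Blocks, their sub-blocks and the initial segments before them\<close>

text \<open>Supplies the independence of all sub-block sums. Lexicographic order on
  \<open>(k, i)\<close> is the order of the intervals on the line, and half-open intervals let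
  neighbours share an endpoint.\<close>

lemma disjoint_family_on_blocks:
  fixes b L j :: "nat \<Rightarrow> nat"
  assumes step: "\<And>k. b k + j k * L k \<le> b (Suc k)"
  shows "disjoint_family_on (\<lambda>(k, i). {b k + i * L k<..b k + Suc i * L k}) {(k, i). i < j k}"
proof -
  have mono: "mono b"
    by (intro incseq_SucI add_leD1[OF step])
  have block: "b k + Suc i * L k \<le> b (Suc k)" if "i < j k" for k i
  proof -
    have "Suc i * L k \<le> j k * L k"
      using that by (intro mult_right_mono) auto
    with step[of k] show ?thesis by linarith
  qed
  have ordered: "b k + Suc i * L k \<le> b k' + i' * L k'"
    if "i < j k" "k < k' \<or> k = k' \<and> i < i'" for k i k' i'
    using that(2)
  proof
    assume "k < k'"
    then have "b (Suc k) \<le> b k'"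
      by (intro monoD[OF mono]) simp
    with block[OF that(1)] show ?thesis by linarith
  next
    assume "k = k' \<and> i < i'"
    moreover from this have "Suc i * L k \<le> i' * L k"
      by (intro mult_le_mono1) simp
    ultimately show ?thesis by simp
  qed
  have "{b k + i * L k<..b k + Suc i * L k} \<inter> {b k' + i' * L k'<..b k' + Suc i' * L k'} = {}"
    if "i < j k" "i' < j k'" "(k, i) \<noteq> (k', i')" for k i k' i'
  proof -
    have "(k < k' \<or> k = k' \<and> i < i') \<or> (k' < k \<or> k' = k \<and> i' < i)"
      using that(3) by auto
    then have "b k + Suc i * L k \<le> b k' + i' * L k' \<or> b k' + Suc i' * L k' \<le> b k + i * L k"
      using ordered[OF that(1), of k' i'] ordered[OF that(2), of k i] by blast
    then show ?thesis
      by (auto simp del: mult_Suc)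
  qed
  then show ?thesis
    unfolding disjoint_family_on_def by (clarsimp simp del: mult_Suc)
qed

lemma sum_append_blocks:
  fixes f :: "nat \<Rightarrow> real"
  shows "(\<Sum>m\<in>{1..b + n * L}. f m) = (\<Sum>m\<in>{1..b}. f m) + (\<Sum>i<n. \<Sum>m\<in>{b + i * L<..b + Suc i * L}. f m)"
proof (induction n)
  case (Suc n)
  have "{1..b + Suc n * L} = {1..b + n * L} \<union> {b + n * L<..b + Suc n * L}"
    by auto
  then have "(\<Sum>m\<in>{1..b + Suc n * L}. f m) =
      (\<Sum>m\<in>{1..b + n * L}. f m) + (\<Sum>m\<in>{b + n * L<..b + Suc n * L}. f m)"
    by (simp only:) (rule sum.union_disjoint, auto)
  with Suc show ?case by simp
qed simp

context rademacher
begin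

text \<open>
  Asking all \<open>j k\<close> sub-blocks of block \<open>k\<close> to exceed a quarter of their standard deviation costs
  only a factor \<open>1/20\<close> each, while the sub-block sums add up to \<open>j k\<close> such deviations.
\<close>

lemma AE_INFM_all_blocks_large:
  fixes b L j :: "nat \<Rightarrow> nat"
  assumes step: "\<And>k. b k + j k * L k \<le> b (Suc k)"
    and L: "\<And>k. 0 < L k"
    and j: "\<And>k. 0 < k \<Longrightarrow> 20 ^ j k \<le> k"
    and \<delta>: "0 < \<delta>" "\<And>m. \<delta> \<le> \<bar>a m\<bar>"
  shows "AE \<omega> in M. \<exists>\<^sub>\<infinity>k. \<forall>i<j k.
    \<delta> * sqrt (L k) / 4 \<le> signed_sum a {b k + i * L k<..b k + Suc i * L k} \<omega>"
proof -
  define T where "T = (\<lambda>(k, i). {b k + i * L k<..b k + Suc i * L k})"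
  define t where "t k = \<delta> * sqrt (L k) / 4" for k
  define V where "V k \<omega> \<longleftrightarrow> (\<forall>i\<in>{..<j k}. t k \<le> signed_sum a (T (k, i)) \<omega>)" for k \<omega>
  define I where "I = {(k, i). i < j k}"
  have indep_T: "indep_vars (\<lambda>_. borel) (\<lambda>z. signed_sum a (T z)) I"
    unfolding T_def I_def by (intro indep_vars_signed_sum disjoint_family_on_blocks step)
  \<comment> \<open>The event \<open>V k\<close> depends only on the sub-block sums with first index
    \<open>k\<close>, and these groups of indices are disjoint.\<close>
  have "indep_vars (\<lambda>_. count_space UNIV)
      (\<lambda>k \<omega>. (\<lambda>f. \<forall>i\<in>{..<j k}. t k \<le> f (k, i))
        (restrict (\<lambda>z. signed_sum a (T z) \<omega>) ({k} \<times> {..<j k}))) UNIV"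
    by (rule indep_vars_compose2[OF indep_vars_restrict[OF indep_T]])
      (auto simp: I_def disjoint_family_on_def)
  also have "(\<lambda>k \<omega>. (\<lambda>f. \<forall>i\<in>{..<j k}. t k \<le> f (k, i))
      (restrict (\<lambda>z. signed_sum a (T z) \<omega>) ({k} \<times> {..<j k}))) = V"
    by (intro ext) (simp add: V_def)
  finally have indep_V: "indep_vars (\<lambda>_. count_space UNIV) V UNIV" .
  have sub: "1 / 20 \<le> prob {\<omega> \<in> space M. t k \<le> signed_sum a (T (k, i)) \<omega>}" for k i
    unfolding t_def
  proof (rule prob_signed_sum_ge)
    have "(\<delta> * sqrt (L k))\<^sup>2 = (\<Sum>m\<in>T (k, i). \<delta>\<^sup>2)"
      by (simp add: T_def power_mult_distrib)
    also have "\<dots> \<le> (\<Sum>m\<in>T (k, i). (a m)\<^sup>2)"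
    proof (rule sum_mono)
      show "\<delta>\<^sup>2 \<le> (a m)\<^sup>2" for m
        using power_mono[OF \<delta>(2)[of m], of 2] \<delta>(1) by simp
    qed
    finally show "(\<delta> * sqrt (L k))\<^sup>2 \<le> (\<Sum>m\<in>T (k, i). (a m)\<^sup>2)" .
  qed (use L \<delta> in \<open>auto simp: T_def\<close>)
  have V_ge: "(1 / 20) ^ j k \<le> prob {\<omega> \<in> space M. V k \<omega>}" for k
  \<comment> \<open>With no sub-blocks \<open>V k\<close> is vacuous and has probability 1. This
    case is split off because an empty intersection is not \<open>space M\<close>.\<close>
  proof (cases "j k = 0")
    case True
    then show ?thesis by (simp add: V_def prob_space)
  next
    case False
    define J where "J = {k} \<times> {..<j k}"
    have "(1 / 20) ^ j k = (\<Prod>z\<in>J. 1 / 20 :: real)"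
      by (simp add: J_def card_cartesian_product)
    also have "\<dots> \<le> (\<Prod>z\<in>J. prob (signed_sum a (T z) -` {t k..} \<inter> space M))"
    proof (intro prod_mono conjI)
      fix z assume "z \<in> J"
      then obtain i where "z = (k, i)" by (auto simp: J_def)
      then have "signed_sum a (T z) -` {t k..} \<inter> space M =
          {\<omega> \<in> space M. t k \<le> signed_sum a (T (k, i)) \<omega>}"
        by auto
      then show "1 / 20 \<le> prob (signed_sum a (T z) -` {t k..} \<inter> space M)"
        using sub[of k i] by simp
    qed simp
    also have "\<dots> = prob (\<Inter>z\<in>J. signed_sum a (T z) -` {t k..} \<inter> space M)"
      using False by (intro indep_varsD[OF indep_T, symmetric]) (auto simp: J_def I_def)
    also have "(\<Inter>z\<in>J. signed_sum a (T z) -` {t k..} \<inter> space M) = {\<omega> \<in> space M. V k \<omega>}"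
      using False by (auto simp: J_def V_def)
    finally show ?thesis .
  qed
  have "\<not> summable (\<lambda>k. prob {\<omega> \<in> space M. V k \<omega>})"
  proof
    assume "summable (\<lambda>k. prob {\<omega> \<in> space M. V k \<omega>})"
    \<comment> \<open>Since \<open>20 ^ j k \<le> k\<close>, the probabilities dominate the harmonic
      series.\<close>
    then have "summable (\<lambda>k. inverse (of_nat k) :: real)"
    proof (rule summable_comparison_test[rotated], intro exI allI impI)
      fix k :: nat assume "1 \<le> k"
      then have "20 ^ j k \<le> k"
        by (intro j) simp
      then have "(20::real) ^ j k \<le> real k"
        by (metis of_nat_le_iff of_nat_numeral of_nat_power)
      then have "inverse (real k) \<le> inverse (20 ^ j k)"
        by (intro le_imp_inverse_le) auto
      also have "\<dots> = (1 / 20) ^ j k"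
        by (simp add: power_one_over inverse_eq_divide)
      finally show "norm (inverse (real k)) \<le> prob {\<omega> \<in> space M. V k \<omega>}"
        using V_ge[of k] by simp
    qed
    then show False
      using not_summable_harmonic by blast
  qed
  then have "AE \<omega> in M. \<exists>\<^sub>\<infinity>k. V k \<omega>"
    by (rule borel_cantelli_AE2[OF indep_V])
  then show ?thesis
    by (simp add: V_def T_def t_def lessThan_iff Ball_def)
qed

text \<open>
  The initial segment is shorter than a sub-block by the factor \<open>4 ^ k\<close>, so Chebyshev's inequality
  is enough to neglect its contribution.
\<close>

lemma AE_eventually_initial_segment_small:
  assumes a: "\<And>m. \<bar>a m\<bar> \<le> 1" and "0 < \<eta>"
  shows "AE \<omega> in M. \<forall>\<^sub>F k in sequentially.
    \<bar>signed_sum a {1..4 ^ k\<^sup>2} \<omega>\<bar> < \<eta> * sqrt (4 ^ (k\<^sup>2 + k))"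
proof -
  define A where "A k = {\<omega> \<in> space M. \<eta> * sqrt (4 ^ (k\<^sup>2 + k)) \<le> \<bar>signed_sum a {1..4 ^ k\<^sup>2} \<omega>\<bar>}" for k
  have A [measurable]: "A k \<in> events" for k
    unfolding A_def by measurable
  have le: "prob (A k) \<le> inverse (\<eta>\<^sup>2) * (1 / 4) ^ k" for k
  proof -
    have "prob (A k) \<le> (\<Sum>m\<in>{1..4 ^ k\<^sup>2}. (a m)\<^sup>2) / (\<eta> * sqrt (4 ^ (k\<^sup>2 + k)))\<^sup>2"
      unfolding A_def using \<open>0 < \<eta>\<close> by (intro prob_abs_signed_sum_ge_le) auto
    also have "\<dots> \<le> (\<Sum>m\<in>{1..4 ^ k\<^sup>2 :: nat}. 1) / (\<eta> * sqrt (4 ^ (k\<^sup>2 + k)))\<^sup>2"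
      using a by (intro divide_right_mono sum_mono) (auto simp: abs_square_le_1)
    also have "\<dots> = 4 ^ k\<^sup>2 / (\<eta>\<^sup>2 * 4 ^ (k\<^sup>2 + k))"
      by (simp add: power_mult_distrib)
    also have "\<dots> = inverse (\<eta>\<^sup>2) * (1 / 4) ^ k"
      by (simp add: power_add power_one_over field_simps)
    finally show ?thesis .
  qed
  have "summable (\<lambda>k. prob (A k))"
    by (rule summable_comparison_test'[where g = "\<lambda>k. inverse (\<eta>\<^sup>2) * (1 / 4) ^ k" and N = 0])
      (use le in \<open>auto intro!: summable_mult summable_geometric\<close>)
  then have "AE \<omega> in M. \<forall>\<^sub>F k in sequentially. \<omega> \<in> space M - A k"
    by (intro borel_cantelli_AE1) (auto simp: less_top[symmetric])
  then show ?thesis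
    by (rule AE_mp) (auto simp: A_def not_le elim: eventually_mono)
qed

end

section \<open>The lower bound of iterated logarithm type\<close>

text \<open>From \<open>Suc k \<le> 20 ^ Suc j\<close> the logarithm of \<open>x\<close> is at most
  a power of 20 with exponent linear in \<open>j\<close>, so a second logarithm is of order
  \<open>j\<close>.\<close>

lemma ln_ln_block_end_le:
  fixes x :: real
  assumes "1 \<le> j" "k < 20 ^ Suc j" "1 < x" "x \<le> 4 ^ (Suc k)\<^sup>2"
  shows "ln (ln x) \<le> 95 * real j"
proof -
  have "ln x \<le> ln (4 ^ (Suc k)\<^sup>2)"
    using assms(3,4) by (subst ln_le_cancel_iff) auto
  also have "\<dots> = real ((Suc k)\<^sup>2) * ln 4"
    by (simp add: ln_realpow)
  also have "\<dots> \<le> real ((Suc k)\<^sup>2) * 3"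
    using ln_le_minus_one[of 4] by (intro mult_left_mono) auto
  \<comment> \<open>The factor 3 is enlarged to 20 so that the bound is a pure power of 20.\<close>
  also have "\<dots> \<le> real ((20 ^ Suc j)\<^sup>2) * 20"
  proof -
    have "(Suc k)\<^sup>2 \<le> (20 ^ Suc j)\<^sup>2"
      using assms(2) by (intro power_mono) auto
    then show ?thesis
      by (intro mult_mono of_nat_mono) auto
  qed
  also have "\<dots> = 20 ^ (2 * j + 3)"
    by (simp add: power_add power_mult power2_eq_square power_mult_distrib eval_nat_numeral)
  finally have "ln (ln x) \<le> ln (20 ^ (2 * j + 3))"
    using assms(3) by (subst ln_le_cancel_iff) auto
  also have "\<dots> = real (2 * j + 3) * ln 20"
    by (rule ln_realpow)
  \<comment> \<open>Here \<open>2 * j + 3 \<le> 5 * j\<close> because \<open>1 \<le> j\<close>, and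
    \<open>ln 20 \<le> 19\<close>; 95 is 5 * 19.\<close>
  also have "\<dots> \<le> real (5 * j) * 19"
    using ln_le_minus_one[of 20] assms(1) by (intro mult_mono) auto
  finally show ?thesis by simp
qed

context rademacher
begin

lemma AE_INFM_signed_sum_ge:
  assumes a: "\<And>m. \<delta> \<le> \<bar>a m\<bar>" "\<And>m. \<bar>a m\<bar> \<le> 1" and "0 < \<delta>"
  shows "AE \<omega> in M. \<exists>\<^sub>\<infinity>x::nat.
    \<delta> / 112 * sqrt x * sqrt (ln (ln x)) \<le> signed_sum a {1..x} \<omega>"
proof -
  \<comment> \<open>\<open>j k\<close> is the integer part of the logarithm of \<open>k\<close> to
    base 20, set to 0 at \<open>k = 0\<close>. Its lower estimate of \<open>k\<close> keeps the
    block probabilities above \<open>1 / k\<close>; the upper one keeps \<open>ln (ln x)\<close> of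
    order \<open>j k\<close>.\<close>
  have "\<exists>j. (if k = 0 then j = 0 else 20 ^ j \<le> k) \<and> k < 20 ^ Suc j" for k :: nat
    using ex_power_ivl1[of 20 k] by (cases "k = 0") (auto intro: exI[of _ 0])
  then obtain j :: "nat \<Rightarrow> nat" where j0: "j 0 = 0" and j: "\<And>k. 0 < k \<Longrightarrow> 20 ^ j k \<le> k"
    and j': "\<And>k. k < 20 ^ Suc (j k)"
    by (metis less_irrefl)
  \<comment> \<open>The ratio \<open>L k / b k = 4 ^ k\<close> makes the initial segment negligible,
    and \<open>b (Suc k) = 4 ^ Suc k * L k\<close> leaves room for all \<open>j k\<close>
    sub-blocks.\<close>
  define b :: "nat \<Rightarrow> nat" where "b k = 4 ^ k\<^sup>2" for k
  define L :: "nat \<Rightarrow> nat" where "L k = 4 ^ (k\<^sup>2 + k)" for k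
  define x where "x k = b k + j k * L k" for k
  have b_le_L: "b k \<le> L k" for k
    unfolding b_def L_def by (rule power_increasing) auto
  have b_ge: "k < b k" for k
  proof -
    have "k \<le> k\<^sup>2" by (simp add: power2_eq_square)
    also have "k\<^sup>2 < 4 ^ k\<^sup>2" by (rule power_gt_expt) simp
    finally show ?thesis by (simp add: b_def)
  qed
  have j_le: "j k < 4 ^ Suc k" for k
  proof (cases "k = 0")
    case True
    then show ?thesis using j0 by simp
  next
    case False
    have "j k < 20 ^ j k" by (rule power_gt_expt) simp
    also have "\<dots> \<le> k" using False j by simp
    also have "k < 4 ^ k" by (rule power_gt_expt) simp
    also have "4 ^ k \<le> (4::nat) ^ Suc k" by simp
    finally show ?thesis .
  qed
  have step: "x k \<le> b (Suc k)" for k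
  proof -
    have "x k \<le> (1 + j k) * L k"
      using b_le_L[of k] by (simp add: x_def)
    also have "\<dots> \<le> 4 ^ Suc k * L k"
      using j_le[of k] by (intro mult_right_mono) auto
    also have "\<dots> = b (Suc k)"
      by (simp add: b_def L_def power2_eq_square power_add algebra_simps)
    finally show ?thesis .
  qed
  \<comment> \<open>\<open>20 \<le> k\<close> forces \<open>1 \<le> j k\<close>. The initial segment
    may cost \<open>\<delta> / 8 * sqrt (L k)\<close>, half of what a single sub-block
    gains.\<close>
  have bound: "\<delta> / 112 * sqrt (x k) * sqrt (ln (ln (x k))) \<le> signed_sum a {1..x k} \<omega>"
    if k: "20 \<le> k"
      and blocks: "\<forall>i<j k. \<delta> * sqrt (L k) / 4 \<le> signed_sum a {b k + i * L k<..b k + Suc i * L k} \<omega>"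
      and init: "\<bar>signed_sum a {1..b k} \<omega>\<bar> < \<delta> / 8 * sqrt (L k)" for k \<omega>
  proof -
    have j1: "1 \<le> j k"
      using j'[of k] k by (cases "j k") auto
    have x1: "1 < x k"
      using b_ge[of k] k by (simp add: x_def)
    have "x k \<le> (1 + j k) * L k"
      using b_le_L[of k] by (simp add: x_def)
    also have "\<dots> \<le> (2 * j k) * L k"
      using j1 by (intro mult_right_mono) auto
    finally have "real (x k) \<le> 2 * real (j k) * real (L k)"
      by (metis of_nat_le_iff of_nat_mult of_nat_numeral)
    moreover have "ln (ln (x k)) \<le> 95 * real (j k)"
    proof (rule ln_ln_block_end_le[OF j1 j'])
      have "real (x k) \<le> real (b (Suc k))"
        using step by (rule of_nat_mono)
      then show "real (x k) \<le> 4 ^ (Suc k)\<^sup>2"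
        by (simp add: b_def)
    qed (use x1 in simp)
    ultimately have "sqrt (x k) \<le> sqrt (2 * real (j k) * real (L k))"
      "sqrt (ln (ln (x k))) \<le> sqrt (95 * real (j k))"
      by simp_all
    then have "sqrt (x k) * sqrt (ln (ln (x k))) \<le> sqrt (x k) * sqrt (95 * real (j k))"
      and "sqrt (x k) * sqrt (95 * real (j k)) \<le> sqrt (2 * real (j k) * real (L k)) * sqrt (95 * real (j k))"
      by (auto intro: mult_left_mono mult_right_mono)
    then have "sqrt (x k) * sqrt (ln (ln (x k))) \<le> sqrt (2 * real (j k) * real (L k)) * sqrt (95 * real (j k))"
      by (rule order_trans)
    also have "\<dots> = sqrt (190 * (real (j k))\<^sup>2 * real (L k))"
      by (simp add: power2_eq_square flip: real_sqrt_mult)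
    \<comment> \<open>190 = 2 * 95 is rounded up to the square 196.\<close>
    also have "\<dots> \<le> sqrt (14\<^sup>2 * (real (j k))\<^sup>2 * real (L k))"
      by (intro real_sqrt_le_mono mult_right_mono) auto
    also have "\<dots> = 14 * real (j k) * sqrt (L k)"
      by (simp add: real_sqrt_mult)
    finally have "\<delta> / 112 * (sqrt (x k) * sqrt (ln (ln (x k)))) \<le> \<delta> / 112 * (14 * real (j k) * sqrt (L k))"
      using \<open>0 < \<delta>\<close> by (intro mult_left_mono) auto
    \<comment> \<open>The constant 112 = 8 * 14 is chosen so that
      \<open>\<delta> / 8 = \<delta> / 4 - \<delta> / 8\<close> remains for each sub-block.\<close>
    also have "\<dots> = real (j k) * (\<delta> * sqrt (L k) / 4) - real (j k) * (\<delta> / 8 * sqrt (L k))"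
      by (simp add: field_simps)
    also have "\<dots> \<le> real (j k) * (\<delta> * sqrt (L k) / 4) - 1 * (\<delta> / 8 * sqrt (L k))"
      using j1 \<open>0 < \<delta>\<close> by (intro diff_left_mono mult_right_mono) auto
    also have "real (j k) * (\<delta> * sqrt (L k) / 4) = (\<Sum>i<j k. \<delta> * sqrt (L k) / 4)"
      by simp
    also have "\<dots> \<le> (\<Sum>i<j k. signed_sum a {b k + i * L k<..b k + Suc i * L k} \<omega>)"
      using blocks by (intro sum_mono) auto
    also have "\<dots> - 1 * (\<delta> / 8 * sqrt (L k)) \<le> signed_sum a {1..x k} \<omega>"
      using init unfolding x_def signed_sum_def sum_append_blocks by linarith
    finally show ?thesis
      by (simp add: mult.assoc)
  qed
  have "AE \<omega> in M. \<exists>\<^sub>\<infinity>k. \<forall>i<j k.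
      \<delta> * sqrt (L k) / 4 \<le> signed_sum a {b k + i * L k<..b k + Suc i * L k} \<omega>"
    using step j a \<open>0 < \<delta>\<close> by (intro AE_INFM_all_blocks_large) (auto simp: x_def L_def)
  moreover have "AE \<omega> in M. \<forall>\<^sub>F k in sequentially.
      \<bar>signed_sum a {1..b k} \<omega>\<bar> < \<delta> / 8 * sqrt (L k)"
    using AE_eventually_initial_segment_small[of a "\<delta> / 8"] a \<open>0 < \<delta>\<close>
    by (simp add: b_def L_def)
  ultimately show ?thesis
  proof eventually_elim
    case (elim \<omega>)
    from elim(2) obtain K where
      K: "\<And>k. K \<le> k \<Longrightarrow> \<bar>signed_sum a {1..b k} \<omega>\<bar> < \<delta> / 8 * sqrt (L k)"
      by (auto simp: eventually_sequentially)
    show ?case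
      unfolding INFM_nat_le
    proof
      fix N
      obtain k where k: "max (max K 20) N \<le> k"
        "\<forall>i<j k. \<delta> * sqrt (L k) / 4 \<le> signed_sum a {b k + i * L k<..b k + Suc i * L k} \<omega>"
        using elim(1) unfolding INFM_nat_le by blast
      \<comment> \<open>As \<open>k < b k \<le> x k\<close>, infinitely many good \<open>k\<close>
        give arbitrarily large \<open>x\<close>.\<close>
      then have "N \<le> x k"
        using b_ge[of k] by (simp add: x_def)
      moreover have "\<delta> / 112 * sqrt (x k) * sqrt (ln (ln (x k))) \<le> signed_sum a {1..x k} \<omega>"
        using k K by (intro bound) auto
      ultimately show "\<exists>n\<ge>N. \<delta> / 112 * sqrt n * sqrt (ln (ln n)) \<le> signed_sum a {1..n} \<omega>"
        by blast
    qed
  qed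
qed

end

section \<open>A model of the random signs, the Beatty weights, and Fubini\<close>

abbreviation coin_space :: "(nat \<Rightarrow> bool) measure" where
  "coin_space \<equiv> Pi\<^sub>M UNIV (\<lambda>_. measure_pmf (bernoulli_pmf (1 / 2)))"

definition coin_sign :: "nat \<Rightarrow> (nat \<Rightarrow> bool) \<Rightarrow> real" where
  "coin_sign n \<omega> = (if \<omega> n then 1 else -1)"

lemma rademacher_coin_sign: "rademacher coin_space coin_sign"
proof -
  interpret prob_space coin_space
    by (intro prob_space_PiM measure_pmf.prob_space_axioms)
  define N where "N = measure_pmf (bernoulli_pmf (1 / 2))"
  have component: "distr coin_space N (\<lambda>\<omega>. \<omega> n) = N" for n
    unfolding N_def by (intro distr_PiM_component measure_pmf.prob_space_axioms) auto
  have coordinate [measurable]: "(\<lambda>\<omega>. \<omega> n) \<in> measurable coin_space N" for n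
    unfolding N_def by measurable
  \<comment> \<open>The joint law of the coordinates is that of the identity map, which is the
    product of the marginals.\<close>
  have "indep_vars (\<lambda>_. N) (\<lambda>n \<omega>. \<omega> n) UNIV"
    by (subst indep_vars_iff_distr_eq_PiM) (simp_all add: component, simp add: N_def restrict_UNIV distr_id)
  then have "indep_vars (\<lambda>_. borel) (\<lambda>n \<omega>. (\<lambda>b. if b then 1 else -1 :: real) (\<omega> n)) UNIV"
    by (rule indep_vars_compose2) (simp add: N_def)
  moreover have "expectation (coin_sign n) = 0" for n
  proof -
    have "expectation (coin_sign n) = (\<integral>b. (if b then 1 else -1) \<partial>distr coin_space N (\<lambda>\<omega>. \<omega> n))"
      unfolding coin_sign_def by (subst integral_distr) (auto simp: N_def)
    also have "\<dots> = 0"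
      unfolding component by (simp add: N_def)
    finally show ?thesis .
  qed
  ultimately show ?thesis
    by unfold_locales (auto simp: coin_sign_def[abs_def])
qed

definition beatty_weight :: "real \<Rightarrow> nat \<Rightarrow> real" where
  "beatty_weight \<alpha> m = indicator (beatty \<alpha>) m - 1 / \<alpha>"

text \<open>Fubini needs measurability in \<open>\<alpha>\<close>. Membership of a fixed
  \<open>m\<close> in the Beatty sequence is a countable disjunction of Borel conditions on
  \<open>\<alpha>\<close>.\<close>

lemma beatty_weight_measurable [measurable]:
  "(\<lambda>\<alpha>. beatty_weight \<alpha> m) \<in> borel_measurable borel"
proof -
  have "beatty_weight \<alpha> m = (if \<exists>n\<ge>1. m = nat \<lfloor>real n * \<alpha>\<rfloor> then 1 else 0) - 1 / \<alpha>" for \<alpha>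
    by (auto simp: beatty_weight_def beatty_def indicator_def)
  then show ?thesis by simp
qed

text \<open>The weight takes only the values \<open>1 - 1 / \<alpha>\<close> and
  \<open>- 1 / \<alpha>\<close>.\<close>

lemma abs_beatty_weight_bounds:
  assumes "1 < \<alpha>"
  shows "min (1 / \<alpha>) (1 - 1 / \<alpha>) \<le> \<bar>beatty_weight \<alpha> m\<bar>" "\<bar>beatty_weight \<alpha> m\<bar> \<le> 1"
  using assms by (auto simp: beatty_weight_def indicator_def min_def field_simps)

lemma S_beatty_minus_S_full:
  "S_beatty \<alpha> f (real x) - S_full f (real x) / \<alpha> = (\<Sum>m\<in>{1..x}. beatty_weight \<alpha> m * f m)"
proof -
  have "S_beatty \<alpha> f (real x) = (\<Sum>m\<in>{1..x} \<inter> beatty \<alpha>. f m)"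
    unfolding S_beatty_def by (rule sum.cong) auto
  also have "\<dots> = (\<Sum>m\<in>{1..x}. indicator (beatty \<alpha>) m * f m)"
    by (simp add: sum.inter_restrict indicator_def if_distrib[where f = "\<lambda>c. c * _"] cong: if_cong)
  finally have "S_beatty \<alpha> f (real x) = (\<Sum>m\<in>{1..x}. indicator (beatty \<alpha>) m * f m)" .
  moreover have "S_full f (real x) = (\<Sum>m\<in>{1..x}. f m)"
    unfolding S_full_def by (rule sum.cong) auto
  ultimately show ?thesis
    by (simp add: beatty_weight_def left_diff_distrib sum_subtractf sum_divide_distrib)
qed

lemma l2_trunc_signs:
  assumes "\<And>n. n \<ge> 1 \<Longrightarrow> f n = 1 \<or> f n = -1"
  shows "l2_trunc f (real x) = sqrt (real x)"
proof -
  have "(\<Sum>m\<in>{m. 1 \<le> m \<and> real m \<le> real x}. (f m)\<^sup>2) = (\<Sum>m\<in>{1..x}. 1)"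
    using assms by (intro sum.cong) (auto simp: power2_eq_1_iff)
  then show ?thesis by (simp add: l2_trunc_def)
qed

theorem mainTheorem3:
  shows "\<exists>f0 :: nat \<Rightarrow> real. (\<forall>n\<ge>1. f0 n = 1 \<or> f0 n = -1) \<and>
    (AE \<alpha> in lborel. \<alpha> > 1 \<longrightarrow>
       (\<exists>c > 0. \<exists>\<^sub>\<infinity> x :: nat.
          S_beatty \<alpha> f0 (real x) - S_full f0 (real x) / \<alpha>
            \<ge> c * l2_trunc f0 (real x) * sqrt (ln (ln (real x)))))"
proof -
  interpret rademacher coin_space coin_sign
    by (rule rademacher_coin_sign)
  interpret pair_sigma_finite lborel coin_space
    by unfold_locales
  define c where "c \<alpha> = min (1 / \<alpha>) (1 - 1 / \<alpha>) / 112" for \<alpha> :: real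
  \<comment> \<open>"Infinitely often" is spelled out with countable quantifiers, which makes joint
    measurability in \<open>\<alpha>\<close> and \<open>\<omega>\<close> routine.\<close>
  define P where "P \<alpha> \<omega> \<longleftrightarrow> (1 < \<alpha> \<longrightarrow> (\<forall>N. \<exists>x\<ge>N. c \<alpha> * sqrt (real x) * sqrt (ln (ln (real x)))
      \<le> (\<Sum>m\<in>{1..x}. beatty_weight \<alpha> m * coin_sign m \<omega>)))" for \<alpha> \<omega>
  have "AE \<alpha> in lborel. AE \<omega> in coin_space. P \<alpha> \<omega>"
  proof (rule AE_I2)
    fix \<alpha> :: real
    show "AE \<omega> in coin_space. P \<alpha> \<omega>"
    proof (cases "1 < \<alpha>")
      case True
      then have "0 < min (1 / \<alpha>) (1 - 1 / \<alpha>)"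
        by (simp add: field_simps)
      from AE_INFM_signed_sum_ge[OF abs_beatty_weight_bounds[OF True] this] show ?thesis
        by (simp add: P_def c_def INFM_nat_le signed_sum_def)
    qed (simp add: P_def)
  qed
  moreover have "{z \<in> space (lborel \<Otimes>\<^sub>M coin_space). P (fst z) (snd z)} \<in> sets (lborel \<Otimes>\<^sub>M coin_space)"
    unfolding P_def c_def by measurable
  ultimately have "AE \<omega> in coin_space. AE \<alpha> in lborel. P \<alpha> \<omega>"
    by (simp add: AE_commute)
  \<comment> \<open>On a probability space an almost sure property holds at some point, which yields
    a single sign sequence for almost every \<open>\<alpha>\<close>.\<close>
  then obtain \<omega> where \<omega>: "AE \<alpha> in lborel. P \<alpha> \<omega>"
    using eventually_happens'[OF ae_filter_bot] by blast
  define f0 where "f0 n = coin_sign n \<omega>" for n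
  have signs: "f0 n = 1 \<or> f0 n = -1" for n
    by (simp add: f0_def coin_sign_def)
  have "AE \<alpha> in lborel. \<alpha> > 1 \<longrightarrow>
       (\<exists>c > 0. \<exists>\<^sub>\<infinity> x :: nat.
          S_beatty \<alpha> f0 (real x) - S_full f0 (real x) / \<alpha>
            \<ge> c * l2_trunc f0 (real x) * sqrt (ln (ln (real x))))"
    using \<omega>
  proof (rule AE_mp, intro AE_I2 impI)
    fix \<alpha> :: real assume "P \<alpha> \<omega>" "1 < \<alpha>"
    moreover from \<open>1 < \<alpha>\<close> have "0 < c \<alpha>"
      by (simp add: c_def field_simps)
    ultimately show "\<exists>c > 0. \<exists>\<^sub>\<infinity> x :: nat.
        S_beatty \<alpha> f0 (real x) - S_full f0 (real x) / \<alpha>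
          \<ge> c * l2_trunc f0 (real x) * sqrt (ln (ln (real x)))"
      by (intro exI[of _ "c \<alpha>"])
        (simp add: P_def INFM_nat_le S_beatty_minus_S_full l2_trunc_signs[OF signs] f0_def[symmetric])
  qed
  with signs show ?thesis by blast
qed

end
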